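(* Let $\{\mathbf n=\mathbf v\oplus\mathbf z,\langle\,,\rangle,\mathbf J_Z\}$ be a metric 2-step nilpotent Lie algebra and $(N,g)$ the corresponding Lie group with left-invariant metric. The eigenvectors of the Laplacian $\Delta$ acting on the invariant (i.e. left-invariant) 1-forms of $N$ are divided into two classes: (A) the X-forms $\theta_Q$, $Q\in\mathbf v$, with eigenvalue $0$; (B) the Z-forms $\vartheta_{Z_\alpha}$ such that $Z_\alpha\in\mathbf z$ is an eigenvector of the quadratic form $T(Z,Z^* )=\mathrm{Tr}\,(\mathbf J_Z\circ\mathbf J_{Z^*})$. The eigenvalues are the negatives of the eigenvalues of this quadratic form. Therefore, the Laplacians acting on invariant 1-forms are isospectral on $\sigma$-equivalent spaces.
   Context: A metric 2-step nilpotent Lie algebra is a system $\{\mathbf n=\mathbf v\oplus\mathbf z,\langle\,,\rangle,\mathbf J_Z\}$ (finite-dimensional, real), where $\mathbf z=[\mathbf n,\mathbf n]$ is the center, $\langle\,,\rangle$ is an inner product with $\mathbf v\perp\mathbf z$, and the one-to-one linear map $\mathbf J:\mathbf z\to \mathrm{End}(\mathbf v)$ is given by $\langle \mathbf J_Z(X),Y\rangle=\langle[X,Y],Z\rangle$; conversely the bracket is determined by $\mathbf J$ and the inner product. The corresponding Lie group $N$ is $\mathbf v\oplus\mathbf z$ with product $(X,Z)(X',Z')=(X+X',Z+Z'+\tfrac12[X,X'])$, with the left-invariant metric $g$ extending $\langle\,,\rangle$. For $Q\in\mathbf v$ and $Z\in\mathbf z$, $\theta_Q=g(Q,\cdot)$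 and $\vartheta_Z=g(Z,\cdot)$ are the left-invariant 1-forms dual to the left-invariant vector fields determined by $Q$ and $Z$. An eigenvector of the quadratic form $T$ with eigenvalue $\tau$ is a nonzero $Z\in\mathbf z$ with $T(Z,Z^* )=\tau\langle Z,Z^*\rangle$ for all $Z^*\in\mathbf z$. The Laplacian on forms is $\Delta=(d-\delta)^2=-(d\delta+\delta d)$, where $\delta$ is the codifferential; on invariant 1-forms $\delta$ acts trivially, so there $\Delta=-\delta d$. If $\sigma$ is an involutive orthogonal transformation of $\mathbf v$ commuting with every $\mathbf J_Z$, $Z\in\mathbf z$, then the $\sigma$-deformation of the Lie algebra is the system $\{\mathbf n_\sigma=\mathbf v\oplus\mathbf z,\langle\,,\rangle,\mathbf J^\sigma_Z\}$ with $\mathbf J^\sigma_Z=\sigma\mathbf J_Z$. The Lie algebras $\mathbf n$ and $\mathbf n_\sigma$, and the corresponding Lie groups with their left-invariant metrics, are called $\sigma$-equivalent. *)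

theory Defs
  imports "HOL-Analysis.Analysis" "HOL-Library.Function_Algebras"
begin

text \<open>
  A metric 2-step nilpotent Lie algebra is given by \<open>J\<close> on the orthogonal direct sum of two
  Euclidean spaces \<open>'v\<close> and \<open>'z\<close>; the inner product is that of the product type.
  The bracket is recovered from \<open>\<langle>J\<^sub>Z X, Y\<rangle> = \<langle>[X, Y], Z\<rangle>\<close>.
\<close>

definition lie_bracket ::
  "('z::euclidean_space \<Rightarrow> 'v::euclidean_space \<Rightarrow> 'v) \<Rightarrow> 'v \<times> 'z \<Rightarrow> 'v \<times> 'z \<Rightarrow> 'v \<times> 'z" where
  "lie_bracket J a b = (0, \<Sum>k\<in>Basis. (J k (fst a) \<bullet> fst b) *\<^sub>R k)"

definition metric_two_step_nilpotent ::
  "('z::euclidean_space \<Rightarrow> 'v::euclidean_space \<Rightarrow> 'v) \<Rightarrow> bool" where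
  "metric_two_step_nilpotent J \<longleftrightarrow>
     bilinear J \<and> inj J \<and>
     (\<forall>Z X Y. J Z X \<bullet> Y = - (X \<bullet> J Z Y)) \<and>
     span {lie_bracket J a b | a b. True} = {0} \<times> UNIV \<and>
     {a. \<forall>b. lie_bracket J a b = 0} = {0} \<times> UNIV"

definition admissible_involution ::
  "('v \<Rightarrow> 'v) \<Rightarrow> ('z::euclidean_space \<Rightarrow> 'v::euclidean_space \<Rightarrow> 'v) \<Rightarrow> bool" where
  "admissible_involution \<sigma> J \<longleftrightarrow>
     orthogonal_transformation \<sigma> \<and> \<sigma> \<circ> \<sigma> = id \<and> (\<forall>Z. \<sigma> \<circ> J Z = J Z \<circ> \<sigma>)"

text \<open>The bracket of the deformation is again obtained from \<^const>\<open>lie_bracket\<close>.\<close>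

definition sigma_deformation :: "('v \<Rightarrow> 'v) \<Rightarrow> ('z \<Rightarrow> 'v \<Rightarrow> 'v) \<Rightarrow> 'z \<Rightarrow> 'v \<Rightarrow> 'v" where
  "sigma_deformation \<sigma> J Z = \<sigma> \<circ> J Z"

definition endo_trace :: "('v::euclidean_space \<Rightarrow> 'v) \<Rightarrow> real" where
  "endo_trace f = (\<Sum>b\<in>Basis. f b \<bullet> b)"

definition quad_T :: "('z \<Rightarrow> 'v::euclidean_space \<Rightarrow> 'v) \<Rightarrow> 'z \<Rightarrow> 'z \<Rightarrow> real" where
  "quad_T J Z W = endo_trace (J Z \<circ> J W)"

definition T_eigenvector ::
  "('z::euclidean_space \<Rightarrow> 'v::euclidean_space \<Rightarrow> 'v) \<Rightarrow> 'z \<Rightarrow> real \<Rightarrow> bool" where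
  "T_eigenvector J Z \<tau> \<longleftrightarrow> Z \<noteq> 0 \<and> (\<forall>W. quad_T J Z W = \<tau> * (Z \<bullet> W))"


subsection \<open>The Lie group and its left-invariant objects\<close>

definition group_mult ::
  "('z::euclidean_space \<Rightarrow> 'v::euclidean_space \<Rightarrow> 'v) \<Rightarrow> 'v \<times> 'z \<Rightarrow> 'v \<times> 'z \<Rightarrow> 'v \<times> 'z" where
  "group_mult J a b = a + b + (1/2) *\<^sub>R lie_bracket J a b"

text \<open>
  All tangent spaces of \<open>N\<close> are identified with the underlying vector space \<open>'v \<times> 'z\<close> by means of
  the global linear coordinates; a vector field is thus a function \<open>'v \<times> 'z \<Rightarrow> 'v \<times> 'z\<close>, a
  \<open>k\<close>-form takes a point and then \<open>k\<close> tangent vectors.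
\<close>

definition left_diff ::
  "('z::euclidean_space \<Rightarrow> 'v::euclidean_space \<Rightarrow> 'v) \<Rightarrow> 'v \<times> 'z \<Rightarrow> 'v \<times> 'z \<Rightarrow> 'v \<times> 'z \<Rightarrow> 'v \<times> 'z" where
  "left_diff J a p = frechet_derivative (group_mult J a) (at p)"

definition left_field ::
  "('z::euclidean_space \<Rightarrow> 'v::euclidean_space \<Rightarrow> 'v) \<Rightarrow> 'v \<times> 'z \<Rightarrow> 'v \<times> 'z \<Rightarrow> 'v \<times> 'z" where
  "left_field J u p = left_diff J p 0 u"

text \<open>The identity of the group is \<open>0\<close> and the inverse of \<open>p\<close> is \<open>- p\<close>.\<close>

definition left_metric ::
  "('z::euclidean_space \<Rightarrow> 'v::euclidean_space \<Rightarrow> 'v) \<Rightarrow> 'v \<times> 'z \<Rightarrow> 'v \<times> 'z \<Rightarrow> 'v \<times> 'z \<Rightarrow> real" where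
  "left_metric J p u w = left_diff J (- p) p u \<bullet> left_diff J (- p) p w"

type_synonym 'n form1 = "'n \<Rightarrow> 'n \<Rightarrow> real"
type_synonym 'n form2 = "'n \<Rightarrow> 'n \<Rightarrow> 'n \<Rightarrow> real"

definition dual_form ::
  "('z::euclidean_space \<Rightarrow> 'v::euclidean_space \<Rightarrow> 'v) \<Rightarrow> 'v \<times> 'z \<Rightarrow> ('v \<times> 'z) form1" where
  "dual_form J u p w = left_metric J p (left_field J u p) w"

definition X_form ::
  "('z::euclidean_space \<Rightarrow> 'v::euclidean_space \<Rightarrow> 'v) \<Rightarrow> 'v \<Rightarrow> ('v \<times> 'z) form1" where
  "X_form J Q = dual_form J (Q, 0)"

definition Z_form ::
  "('z::euclidean_space \<Rightarrow> 'v::euclidean_space \<Rightarrow> 'v) \<Rightarrow> 'z \<Rightarrow> ('v \<times> 'z) form1" where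
  "Z_form J Z = dual_form J (0, Z)"

definition invariant_forms ::
  "('z::euclidean_space \<Rightarrow> 'v::euclidean_space \<Rightarrow> 'v) \<Rightarrow> ('v \<times> 'z) form1 set" where
  "invariant_forms J =
     {\<eta>. (\<forall>p. linear (\<eta> p)) \<and> (\<forall>a p u. \<eta> (group_mult J a p) (left_diff J a p u) = \<eta> p u)}"


subsection \<open>Exterior derivative, codifferential and Laplacian\<close>

definition ext_d0 :: "('n::euclidean_space \<Rightarrow> real) \<Rightarrow> 'n form1" where
  "ext_d0 f p u = frechet_derivative f (at p) u"

definition ext_d1 :: "('n::euclidean_space) form1 \<Rightarrow> 'n form2" where
  "ext_d1 \<omega> p u w =
     frechet_derivative (\<lambda>q. \<omega> q w) (at p) u - frechet_derivative (\<lambda>q. \<omega> q u) (at p) w"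

text \<open>
  Pointwise inner products of forms, computed in the left-invariant frame generated by an
  orthonormal basis, which is orthonormal for the left-invariant metric. The factor \<open>c\<close> fixes the
  normalisation on 2-forms. With \<open>c = 1\<close>, the full contraction of covariant 2-tensors, the
  eigenvalues of the Laplacian on Z-forms are exactly the negatives of those of \<open>quad_T\<close>; with
  \<open>c = 1/2\<close> the products \<open>e\<^sub>i \<and> e\<^sub>j\<close> (\<open>i < j\<close>) are orthonormal, the Laplacian is the
  Hodge-de Rham Laplacian, and all eigenvalues are halved.
\<close>

definition form1_inner ::
  "('z::euclidean_space \<Rightarrow> 'v::euclidean_space \<Rightarrow> 'v) \<Rightarrow> ('v \<times> 'z) form1 \<Rightarrow> ('v \<times> 'z) form1
     \<Rightarrow> 'v \<times> 'z \<Rightarrow> real" where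
  "form1_inner J \<alpha> \<beta> p =
     (\<Sum>i\<in>Basis. \<alpha> p (left_field J i p) * \<beta> p (left_field J i p))"

definition form2_inner ::
  "real \<Rightarrow> ('z::euclidean_space \<Rightarrow> 'v::euclidean_space \<Rightarrow> 'v) \<Rightarrow> ('v \<times> 'z) form2 \<Rightarrow> ('v \<times> 'z) form2
     \<Rightarrow> 'v \<times> 'z \<Rightarrow> real" where
  "form2_inner c J \<alpha> \<beta> p =
     c * (\<Sum>i\<in>Basis. \<Sum>j\<in>Basis.
       \<alpha> p (left_field J i p) (left_field J j p) * \<beta> p (left_field J i p) (left_field J j p))"

text \<open>
  Compactly supported \<open>C\<^sup>1\<close> functions suffice to test formal adjointness of first-order operators.
\<close>

definition test_function :: "('n::euclidean_space \<Rightarrow> real) \<Rightarrow> bool" where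
  "test_function \<phi> \<longleftrightarrow>
     (\<forall>p. \<phi> differentiable (at p)) \<and>
     (\<forall>u. continuous_on UNIV (\<lambda>p. frechet_derivative \<phi> (at p) u)) \<and>
     compact (closure {p. \<phi> p \<noteq> 0})"

definition test_form :: "('n::euclidean_space) form1 \<Rightarrow> bool" where
  "test_form \<alpha> \<longleftrightarrow> (\<forall>p. linear (\<alpha> p)) \<and> (\<forall>w. test_function (\<lambda>p. \<alpha> p w))"

text \<open>
  The codifferential is minus the formal adjoint of the exterior derivative, i.e. it has the sign
  of the divergence, so that \<open>(d - \<delta>)\<^sup>2\<close> is a nonnegative operator. In the linear
  coordinates left translations have unipotent differentials, hence the Riemannian volume of the
  left-invariant metric is Lebesgue measure. Continuity makes the described form unique.
\<close>

definition codiff1 ::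
  "('z::euclidean_space \<Rightarrow> 'v::euclidean_space \<Rightarrow> 'v) \<Rightarrow> ('v \<times> 'z) form1 \<Rightarrow> 'v \<times> 'z \<Rightarrow> real" where
  "codiff1 J \<alpha> =
     (THE f. continuous_on UNIV f \<and>
       (\<forall>\<phi>. test_function \<phi> \<longrightarrow>
          (LINT p|lborel. f p * \<phi> p) = - (LINT p|lborel. form1_inner J \<alpha> (ext_d0 \<phi>) p)))"

definition codiff2 ::
  "real \<Rightarrow> ('z::euclidean_space \<Rightarrow> 'v::euclidean_space \<Rightarrow> 'v) \<Rightarrow> ('v \<times> 'z) form2
     \<Rightarrow> ('v \<times> 'z) form1" where
  "codiff2 c J \<beta> =
     (THE \<gamma>. (\<forall>p. linear (\<gamma> p)) \<and> (\<forall>w. continuous_on UNIV (\<lambda>p. \<gamma> p w)) \<and>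
       (\<forall>\<alpha>. test_form \<alpha> \<longrightarrow>
          (LINT p|lborel. form1_inner J \<gamma> \<alpha> p)
            = - (LINT p|lborel. form2_inner c J \<beta> (ext_d1 \<alpha>) p)))"

definition laplacian ::
  "real \<Rightarrow> ('z::euclidean_space \<Rightarrow> 'v::euclidean_space \<Rightarrow> 'v) \<Rightarrow> ('v \<times> 'z) form1
     \<Rightarrow> ('v \<times> 'z) form1" where
  "laplacian c J \<omega> = - (ext_d0 (codiff1 J \<omega>) + codiff2 c J (ext_d1 \<omega>))"

definition form_scale :: "real \<Rightarrow> 'n form1 \<Rightarrow> 'n form1" where
  "form_scale r \<eta> p u = r * \<eta> p u"

definition laplace_eigenspace ::
  "real \<Rightarrow> ('z::euclidean_space \<Rightarrow> 'v::euclidean_space \<Rightarrow> 'v) \<Rightarrow> real \<Rightarrow> ('v \<times> 'z) form1 set" where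
  "laplace_eigenspace c J \<mu> = {\<eta> \<in> invariant_forms J. laplacian c J \<eta> = form_scale \<mu> \<eta>}"

definition laplace_multiplicity ::
  "real \<Rightarrow> ('z::euclidean_space \<Rightarrow> 'v::euclidean_space \<Rightarrow> 'v) \<Rightarrow> real \<Rightarrow> nat" where
  "laplace_multiplicity c J \<mu> = vector_space.dim form_scale (laplace_eigenspace c J \<mu>)"

end

theory Submission
  imports Defs
begin

text \<open>
  Write \<open>E\<^sub>u\<close> for the left-invariant field and \<open>\<theta>\<^sub>u\<close> for the left-invariant 1-form determined by
  \<open>u = (Q, Z)\<close>. In the global linear coordinates
  \<open>E\<^sub>u(p) = u + [p, u]/2\<close> and \<open>\<theta>\<^sub>u(p)(w) = \<langle>u, w - [p, w]/2\<rangle>\<close>, so \<open>\<theta>\<^sub>u(E\<^sub>w) = \<langle>u, w\<rangle>\<close>, and the invariant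
  1-forms are exactly the \<open>\<theta>\<^sub>u\<close>. Everything about the Laplacian follows from one analytic fact: the
  fields \<open>E\<^sub>u\<close> are divergence free, that is, \<open>\<integral> E\<^sub>u \<phi> = 0\<close> for every compactly supported \<open>C\<^sup>1\<close> function
  \<open>\<phi>\<close> (\<open>has_bochner_integral_left_field\<close>).

  This gives \<open>\<delta> \<theta>\<^sub>u = 0\<close> at once. On the other side \<open>d\<theta>\<^sub>u(E\<^sub>x, E\<^sub>y) = - \<langle>u, [x, y]\<rangle>\<close>, and for a test
  1-form \<open>\<alpha>\<close> one has \<open>d\<alpha>(E\<^sub>x, E\<^sub>y) = E\<^sub>x(\<alpha>(E\<^sub>y)) - E\<^sub>y(\<alpha>(E\<^sub>x)) - \<alpha>([x, y])\<close>,
  of which only the last term survives integration. Pairing the two over an orthonormal frame produces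
  the vector \<open>\<Sum>\<^bsub>i,j\<^esub> \<langle>u, [e\<^sub>i, e\<^sub>j]\<rangle> [e\<^sub>i, e\<^sub>j]\<close>. Skewness of the \<open>J\<close> maps turns this sum into \<open>(0, - T Z)\<close>,
  where \<open>T\<close> now also denotes the symmetric operator that represents the quadratic form
  (\<open>bracket_energy\<close>). Hence \<open>\<delta> d\<theta>\<^sub>u = \<theta>\<^bsub>(0, c T Z)\<^esub>\<close> and \<open>\<Delta> \<theta>\<^sub>u = - \<theta>\<^bsub>(0, c T Z)\<^esub>\<close>
  (\<open>laplacian_dual_form\<close>).

  The eigenvalue equation for \<open>\<theta>\<^bsub>(Q, Z)\<^esub>\<close> thus reads \<open>\<mu> Q = 0\<close> and \<open>- c T Z = \<mu> Z\<close>. Since \<open>J\<close> is injective,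
  \<open>T\<close> is negative definite, so \<open>\<mu> = 0\<close> forces \<open>Z = 0\<close> and \<open>\<mu> \<noteq> 0\<close> forces \<open>Q = 0\<close>: these are the two
  classes. A \<open>\<sigma>\<close>-deformation leaves \<open>T\<close> unchanged, because \<open>\<sigma> J\<^sub>Z \<sigma> J\<^sub>W = \<sigma>\<^sup>2 J\<^sub>Z J\<^sub>W = J\<^sub>Z J\<^sub>W\<close>, and the
  multiplicities depend on \<open>T\<close> and \<open>c\<close> alone.

  The codifferentials are specified by a weak (integrated) identity, so each computation has a
  uniqueness half as well. It rests on the fundamental lemma of the calculus of variations
  (\<open>continuous_eq_if_test_integrals_eq\<close>).
\<close>

section \<open>Compactly supported \<open>C\<^sup>1\<close> functions\<close>

lemma test_function_has_derivative:
  assumes "test_function \<phi>"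
  shows "(\<phi> has_derivative frechet_derivative \<phi> (at p)) (at p)"
  using assms unfolding test_function_def by (simp add: frechet_derivative_works)

lemma test_function_continuous:
  assumes "test_function \<phi>"
  shows "continuous_on UNIV \<phi>"
  using assms unfolding test_function_def
  by (simp add: continuous_at_imp_continuous_on differentiable_imp_continuous_within)

lemma test_functionI:
  assumes "\<And>p. (f has_derivative f' p) (at p)"
    and "\<And>u. continuous_on UNIV (\<lambda>p. f' p u)"
    and "compact K" and "\<And>p. p \<notin> K \<Longrightarrow> f p = 0"
  shows "test_function f"
proof -
  have "frechet_derivative f (at p) = f' p" for p
    using assms(1) by (metis frechet_derivative_at)
  moreover have "closure {p. f p \<noteq> 0} \<subseteq> K"
    using assms(3,4) by (intro closure_minimal compact_imp_closed) auto
  then have "compact (closure {p. f p \<noteq> 0})"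
    using assms(3) by (metis closed_closure compact_Int_closed inf.absorb2)
  ultimately show ?thesis
    using assms(1,2) unfolding test_function_def differentiable_def by auto
qed

lemma test_function_supportE:
  assumes "test_function \<phi>"
  obtains K where "compact K" "\<And>p. p \<notin> K \<Longrightarrow> \<phi> p = 0"
    "\<And>p u. p \<notin> K \<Longrightarrow> frechet_derivative \<phi> (at p) u = 0"
proof
  let ?K = "closure {p. \<phi> p \<noteq> 0}"
  show "compact ?K" using assms unfolding test_function_def by blast
  show *: "\<phi> p = 0" if "p \<notin> ?K" for p
    using that closure_subset[of "{p. \<phi> p \<noteq> 0}"] by blast
  show "frechet_derivative \<phi> (at p) u = 0" if "p \<notin> ?K" for p u
  proof -
    have "(\<phi> has_derivative (\<lambda>_. 0)) (at p)"
    proof (rule has_derivative_transform_within_open[where s = "- ?K" and f = "\<lambda>_. 0"])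
      show "0 = \<phi> q" if "q \<in> - ?K" for q using *[of q] that by simp
    qed (use that in auto)
    then show ?thesis by (metis frechet_derivative_at)
  qed
qed

lemma test_function_add:
  assumes "test_function f" "test_function g"
  shows "test_function (\<lambda>p. f p + g p)"
proof -
  obtain K L where K: "compact K" "\<And>p. p \<notin> K \<Longrightarrow> f p = 0"
    and L: "compact L" "\<And>p. p \<notin> L \<Longrightarrow> g p = 0"
    using assms by (metis test_function_supportE)
  show ?thesis
  proof (rule test_functionI[where K = "K \<union> L"])
    show "((\<lambda>p. f p + g p) has_derivative
        (\<lambda>u. frechet_derivative f (at p) u + frechet_derivative g (at p) u)) (at p)" for p
      by (intro has_derivative_add test_function_has_derivative assms)
    show "continuous_on UNIV (\<lambda>p. frechet_derivative f (at p) u + frechet_derivative g (at p) u)" for u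
      using assms unfolding test_function_def by (intro continuous_on_add) auto
  qed (use K L in auto)
qed

lemma test_function_zero: "test_function (\<lambda>_. 0)"
  by (rule test_functionI[where K = "{}" and f' = "\<lambda>_ _. 0"]) simp_all

lemma test_function_sum:
  assumes "\<And>i. i \<in> I \<Longrightarrow> test_function (f i)"
  shows "test_function (\<lambda>p. \<Sum>i\<in>I. f i p)"
  using assms
proof (induction I rule: infinite_finite_induct)
  case (insert i I)
  then have "test_function (\<lambda>p. f i p + (\<Sum>i\<in>I. f i p))"
    by (intro test_function_add) blast+
  then show ?case using insert.hyps by simp
qed (simp_all add: test_function_zero)

text \<open>
  In linear coordinates the coefficients of left-invariant fields and forms are affine, so this closure
  property covers all products that occur.
\<close>
lemma test_function_affine_mult:
  fixes \<phi> :: "'n::euclidean_space \<Rightarrow> real"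
  assumes "linear l" "test_function \<phi>"
  shows "test_function (\<lambda>p. (a + l p) * \<phi> p)"
proof -
  obtain K where K: "compact K" "\<And>p. p \<notin> K \<Longrightarrow> \<phi> p = 0"
    using assms by (metis test_function_supportE)
  note [continuous_intros] = linear_continuous_on[OF linear_conv_bounded_linear[THEN iffD1, OF assms(1)]]
    test_function_continuous[OF assms(2)]
  show ?thesis
  proof (rule test_functionI[OF _ _ K(1)])
    show "((\<lambda>p. (a + l p) * \<phi> p) has_derivative
        (\<lambda>u. (a + l p) * frechet_derivative \<phi> (at p) u + l u * \<phi> p)) (at p)" for p
      using has_derivative_mult[OF has_derivative_add[OF has_derivative_const
          linear_imp_has_derivative[OF assms(1)]] test_function_has_derivative[OF assms(2)], of a p]
      by simp
    have "continuous_on UNIV (\<lambda>p. frechet_derivative \<phi> (at p) u)" for u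
      using assms unfolding test_function_def by auto
    then show "continuous_on UNIV (\<lambda>p. (a + l p) * frechet_derivative \<phi> (at p) u + l u * \<phi> p)" for u
      by (intro continuous_intros)
  qed (use K in auto)
qed

section \<open>Integration against test functions\<close>

lemma integrable_continuous_compact_support:
  fixes f :: "'n::euclidean_space \<Rightarrow> real"
  assumes "continuous_on UNIV f" "compact K" "\<And>p. p \<notin> K \<Longrightarrow> f p = 0"
  shows "integrable lborel f"
proof -
  have "integrable lborel (\<lambda>p. indicator K p *\<^sub>R f p)"
    by (intro borel_integrable_compact assms continuous_on_subset[OF assms(1)]) auto
  moreover have "(\<lambda>p. indicator K p *\<^sub>R f p) = f"
    using assms(3) by (auto simp: fun_eq_iff indicator_def)
  ultimately show ?thesis by simp
qed

lemma test_function_integrable: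
  assumes "test_function \<phi>" "continuous_on UNIV f"
  shows "integrable lborel (\<lambda>p. f p * \<phi> p)"
proof -
  obtain K where K: "compact K" "\<And>p. p \<notin> K \<Longrightarrow> \<phi> p = 0"
    using assms by (metis test_function_supportE)
  show ?thesis
    by (rule integrable_continuous_compact_support[OF
          continuous_on_mult[OF assms(2) test_function_continuous[OF assms(1)]] K(1)])
      (simp add: K(2))
qed

text \<open>
  The difference quotients of \<open>\<phi>\<close> in direction \<open>w\<close> have integral zero by translation invariance of
  Lebesgue measure. By the mean value theorem they are bounded by the supremum of the derivative and
  they vanish off a fixed compact set, so dominated convergence passes the value to the limit.
\<close>
lemma has_bochner_integral_derivative_test_function:
  fixes \<phi> :: "'n::euclidean_space \<Rightarrow> real"
  assumes \<phi>: "test_function \<phi>"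
  shows "has_bochner_integral lborel (\<lambda>p. frechet_derivative \<phi> (at p) w) 0"
proof -
  let ?D = "\<lambda>p. frechet_derivative \<phi> (at p) w"
  obtain K where K: "compact K" "\<And>p. p \<notin> K \<Longrightarrow> \<phi> p = 0" "\<And>p. p \<notin> K \<Longrightarrow> ?D p = 0"
    using \<phi> by (metis test_function_supportE)
  have contD: "continuous_on UNIV ?D" using \<phi> unfolding test_function_def by blast
  have int: "integrable lborel ?D"
    by (rule integrable_continuous_compact_support[OF contD K(1) K(3)])
  have int\<phi>: "integrable lborel \<phi>"
    using test_function_integrable[OF \<phi>, of "\<lambda>_. 1"] by simp
  have "bounded (?D ` K)"
    by (intro compact_imp_bounded compact_continuous_image K continuous_on_subset[OF contD]) auto
  then obtain M where "\<And>p. p \<in> K \<Longrightarrow> \<bar>?D p\<bar> \<le> M" "M > 0"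
    by (auto simp: bounded_pos)
  then have M: "\<bar>?D p\<bar> \<le> M" for p using K(3)[of p] by fastforce
  \<comment> \<open>Sweeping the support along \<open>- w\<close> covers all points where some difference quotient is nonzero.\<close>
  define L where "L = (\<lambda>(x, t). x - t *\<^sub>R w) ` (K \<times> {0..1::real})"
  have L: "compact L" unfolding L_def
    by (intro compact_continuous_image compact_Times K compact_Icc)
      (auto simp: case_prod_unfold intro!: continuous_intros)
  have L0: "\<phi> (p + t *\<^sub>R w) = 0" if "p \<notin> L" "0 \<le> t" "t \<le> 1" for p t
  proof (rule K(2), rule)
    assume "p + t *\<^sub>R w \<in> K"
    then have "(\<lambda>(x, t). x - t *\<^sub>R w) (p + t *\<^sub>R w, t) \<in> L"
      unfolding L_def using that by (intro imageI) auto
    then show False using that by simp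
  qed
  define q where "q n p = (\<phi> (p + (1 / real (Suc n)) *\<^sub>R w) - \<phi> p) * real (Suc n)" for n p
  have line: "((\<lambda>s. \<phi> (p + s *\<^sub>R w)) has_real_derivative ?D (p + s *\<^sub>R w)) (at s)" for p s
  proof -
    have "((\<lambda>s. \<phi> (p + s *\<^sub>R w)) has_derivative
        (\<lambda>h. frechet_derivative \<phi> (at (p + s *\<^sub>R w)) (h *\<^sub>R w))) (at s)"
      by (rule has_derivative_compose[where f = "\<lambda>s. p + s *\<^sub>R w", OF _ test_function_has_derivative[OF \<phi>]])
        (auto intro!: derivative_eq_intros)
    moreover have "frechet_derivative \<phi> (at x) (h *\<^sub>R w) = ?D x * h" for x h
      using has_derivative_linear[OF test_function_has_derivative[OF \<phi>, of x]]
      by (simp add: linear_cmul)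
    ultimately show ?thesis by (simp add: has_field_derivative_def)
  qed
  have bound: "norm (q n p) \<le> M * indicator L p" for n p
  proof (cases "p \<in> L")
    case True
    let ?t = "1 / real (Suc n)"
    have "\<exists>z>0. z < ?t \<and> \<phi> (p + ?t *\<^sub>R w) - \<phi> (p + 0 *\<^sub>R w) = (?t - 0) * ?D (p + z *\<^sub>R w)"
      by (rule MVT2) (auto intro: line)
    then obtain z where "\<phi> (p + ?t *\<^sub>R w) - \<phi> p = ?t * ?D (p + z *\<^sub>R w)" by auto
    then have "q n p = ?D (p + z *\<^sub>R w)" unfolding q_def by simp
    then show ?thesis using M True by simp
  next
    case False
    then show ?thesis using L0[of p 0] L0[of p "1 / real (Suc n)"] by (simp add: q_def)
  qed
  have lim: "(\<lambda>n. q n p) \<longlonglongrightarrow> ?D p" for p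
  proof -
    have "((\<lambda>h. (\<phi> (p + (0 + h) *\<^sub>R w) - \<phi> (p + 0 *\<^sub>R w)) / h) \<longlongrightarrow> ?D (p + 0 *\<^sub>R w)) (at 0)"
      using line[of p 0] unfolding DERIV_def .
    then have "((\<lambda>h. (\<phi> (p + h *\<^sub>R w) - \<phi> p) / h) \<longlongrightarrow> ?D p) (at 0)" by simp
    moreover have "filterlim (\<lambda>n. 1 / real (Suc n)) (at 0) sequentially"
      unfolding filterlim_at using LIMSEQ_inverse_real_of_nat by (auto simp: inverse_eq_divide)
    ultimately have "(\<lambda>n. (\<phi> (p + (1 / real (Suc n)) *\<^sub>R w) - \<phi> p) / (1 / real (Suc n))) \<longlonglongrightarrow> ?D p"
      by (rule filterlim_compose)
    then show ?thesis unfolding q_def by simp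
  qed
  have meas [measurable]: "\<phi> \<in> borel_measurable borel"
    by (intro borel_measurable_continuous_onI test_function_continuous \<phi>)
  have shift: "has_bochner_integral lborel (\<lambda>p. \<phi> (p + v)) (integral\<^sup>L lborel \<phi>)" for v
  proof -
    have v: "(+) v \<in> measurable lborel borel" by measurable
    have "integrable lborel (\<lambda>p. \<phi> (v + p))" "(LINT p|lborel. \<phi> (v + p)) = integral\<^sup>L lborel \<phi>"
      using integrable_distr_eq[OF v meas] integral_distr[OF v meas] int\<phi>
      by (simp_all add: lborel_distr_plus)
    then show ?thesis by (simp add: has_bochner_integral_iff add.commute)
  qed
  have q0: "integral\<^sup>L lborel (q n) = 0" for n
  proof -
    have "has_bochner_integral lborel (q n)
        ((integral\<^sup>L lborel \<phi> - integral\<^sup>L lborel \<phi>) * real (Suc n))"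
      unfolding q_def using int\<phi>
      by (intro has_bochner_integral_mult_left has_bochner_integral_diff shift)
        (simp add: has_bochner_integral_iff)
    then show ?thesis by (simp add: has_bochner_integral_iff)
  qed
  have "(\<lambda>n. integral\<^sup>L lborel (q n)) \<longlonglongrightarrow> integral\<^sup>L lborel ?D"
  proof (rule integral_dominated_convergence[where w = "\<lambda>p. M * indicator L p"])
    show "q n \<in> borel_measurable lborel" for n
      unfolding q_def by measurable
    show "integrable lborel (\<lambda>p. M * indicator L p :: real)"
      using L by (intro integrable_mult_right integrable_real_indicator emeasure_bounded_finite)
        (auto simp: compact_imp_bounded compact_imp_closed)
  qed (use int lim bound in auto)
  then have "integral\<^sup>L lborel ?D = 0"
    by (simp add: q0 LIMSEQ_const_iff)
  then show ?thesis using int by (simp add: has_bochner_integral_iff)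
qed

text \<open>
  Squaring the truncated paraboloid gives a bump that is \<open>C\<^sup>1\<close>, since \<open>t \<mapsto> (max 0 t)\<^sup>2\<close> is, and that is
  positive exactly on the open ball when \<open>r > 0\<close>.
\<close>
lemma test_function_bump:
  fixes a :: "'n::euclidean_space"
  shows "test_function (\<lambda>p. (max 0 (r\<^sup>2 - (p - a) \<bullet> (p - a)))\<^sup>2)"
proof -
  have max: "((\<lambda>t. (max 0 t)\<^sup>2) has_real_derivative 2 * max 0 t) (at t)" for t :: real
  proof (cases t "0::real" rule: linorder_cases)
    case less
    have "((\<lambda>t. 0) has_real_derivative 2 * max 0 t) (at t)" using less by simp
    then show ?thesis
      by (rule has_field_derivative_transform_within_open[where S = "{..<0}"]) (use less in auto)
  next
    case greater
    have "((\<lambda>t. t\<^sup>2) has_real_derivative 2 * max 0 t) (at t)"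
      using greater by (auto intro!: derivative_eq_intros)
    then show ?thesis
      by (rule has_field_derivative_transform_within_open[where S = "{0<..}"]) (use greater in auto)
  next
    case equal
    have "((\<lambda>h::real. (max 0 h)\<^sup>2 / h) \<longlongrightarrow> 0) (at 0)"
    proof (rule Lim_null_comparison)
      show "\<forall>\<^sub>F h in at 0. norm ((max 0 h)\<^sup>2 / h :: real) \<le> \<bar>h\<bar>"
        by (auto simp: max_def power2_eq_square)
      show "((\<lambda>h::real. \<bar>h\<bar>) \<longlongrightarrow> 0) (at 0)"
        by (rule tendsto_eq_intros refl)+ simp
    qed
    then show ?thesis using equal by (simp add: DERIV_def)
  qed
  show ?thesis
  proof (rule test_functionI[where K = "cball a \<bar>r\<bar>"])
    show "((\<lambda>p. (max 0 (r\<^sup>2 - (p - a) \<bullet> (p - a)))\<^sup>2) has_derivative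
        (\<lambda>u. 2 * max 0 (r\<^sup>2 - (p - a) \<bullet> (p - a)) * (- 2 * ((p - a) \<bullet> u)))) (at p)" for p
    proof (rule has_derivative_compose[where f = "\<lambda>p. r\<^sup>2 - (p - a) \<bullet> (p - a)",
            OF _ max[unfolded has_field_derivative_def]])
      show "((\<lambda>p. r\<^sup>2 - (p - a) \<bullet> (p - a)) has_derivative (\<lambda>u. - 2 * ((p - a) \<bullet> u))) (at p)"
        by (rule derivative_eq_intros refl)+ (auto simp: inner_commute)
    qed
    show "continuous_on UNIV (\<lambda>p. 2 * max 0 (r\<^sup>2 - (p - a) \<bullet> (p - a)) * (- 2 * ((p - a) \<bullet> u)))" for u
      by (intro continuous_intros)
    show "(max 0 (r\<^sup>2 - (p - a) \<bullet> (p - a)))\<^sup>2 = 0" if "p \<notin> cball a \<bar>r\<bar>" for p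
    proof -
      have "r\<^sup>2 \<le> (dist a p)\<^sup>2" using that by (simp add: abs_le_square_iff[symmetric])
      then show ?thesis by (simp add: dist_norm norm_minus_commute dot_square_norm)
    qed
  qed auto
qed

text \<open>
  The fundamental lemma of the calculus of variations: if \<open>f > g\<close> at a point, then \<open>f > g\<close> on a ball, and
  a bump supported there separates the integrals.
\<close>
lemma continuous_eq_if_test_integrals_eq:
  fixes f g :: "'n::euclidean_space \<Rightarrow> real"
  assumes f: "continuous_on UNIV f" and g: "continuous_on UNIV g"
    and eq: "\<And>\<phi>. test_function \<phi> \<Longrightarrow> (LINT p|lborel. f p * \<phi> p) = (LINT p|lborel. g p * \<phi> p)"
  shows "f = g"
proof -
  have *: "f a \<le> g a" if f: "continuous_on UNIV f" and g: "continuous_on UNIV g"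
    and eq: "\<And>\<phi>. test_function \<phi> \<Longrightarrow> (LINT p|lborel. f p * \<phi> p) = (LINT p|lborel. g p * \<phi> p)"
    for f g :: "'n \<Rightarrow> real" and a
  proof (rule ccontr)
    assume "\<not> f a \<le> g a"
    moreover have "open {p. g p < f p}" using f g by (intro open_Collect_less)
    ultimately obtain r where r: "r > 0" "ball a r \<subseteq> {p. g p < f p}"
      by (metis mem_Collect_eq not_le open_contains_ball)
    define \<phi> where "\<phi> p = (max 0 (r\<^sup>2 - (p - a) \<bullet> (p - a)))\<^sup>2" for p
    have \<phi>: "test_function \<phi>" unfolding \<phi>_def by (rule test_function_bump)
    have in_ball: "p \<in> ball a r \<longleftrightarrow> \<phi> p \<noteq> 0" for p
    proof -
      have "p \<in> ball a r \<longleftrightarrow> (norm (p - a))\<^sup>2 < r\<^sup>2"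
        using r by (auto simp: dist_norm norm_minus_commute intro: power_strict_mono
          dest: power_less_imp_less_base)
      then show ?thesis by (auto simp: \<phi>_def dot_square_norm)
    qed
    have pos: "\<phi> p \<ge> 0" for p by (simp add: \<phi>_def)
    have int: "integrable lborel (\<lambda>p. f p * \<phi> p)" "integrable lborel (\<lambda>p. g p * \<phi> p)"
      using test_function_integrable[OF \<phi>] f g by auto
    have nonneg: "0 \<le> f p * \<phi> p - g p * \<phi> p" for p
      using pos[of p] in_ball[of p] r(2) by (cases "p \<in> ball a r") (auto simp: mult_right_mono)
    have "(LINT p|lborel. f p * \<phi> p - g p * \<phi> p) = 0"
      using eq[OF \<phi>] int by simp
    then have "AE p in lborel. f p * \<phi> p - g p * \<phi> p = 0"
      using int nonneg by (subst (asm) integral_nonneg_eq_0_iff_AE) auto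
    then have "AE p in lborel. p \<notin> ball a r"
      by (rule AE_mp) (use in_ball r(2) in \<open>auto simp: subset_iff intro!: AE_I2\<close>)
    then have "emeasure lborel (ball a r) = 0"
      by (subst (asm) AE_iff_measurable[of "ball a r"]) auto
    then have "negligible (ball a r)"
      by (simp add: negligible_iff_null_sets null_sets_def null_sets_completionI)
    then show False using open_not_negligible[of "ball a r"] r by auto
  qed
  show ?thesis using *[OF f g eq] *[OF g f eq[symmetric]] by (auto simp: fun_eq_iff intro: antisym)
qed

section \<open>Left-invariant fields and forms\<close>

lemma linear_functional_expansion:
  fixes f :: "'n::euclidean_space \<Rightarrow> real"
  assumes "linear f"
  shows "f w = (\<Sum>b\<in>Basis. (w \<bullet> b) * f b)"
proof -
  have "f w = f (\<Sum>b\<in>Basis. (w \<bullet> b) *\<^sub>R b)" by (simp add: euclidean_representation)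
  then show ?thesis by (simp only: linear_sum[OF assms] linear_cmul[OF assms] real_scaleR_def)
qed

lemma sum_Basis_prod:
  fixes f :: "'a::euclidean_space \<times> 'b::euclidean_space \<Rightarrow> real"
  shows "sum f Basis = (\<Sum>i\<in>Basis. f (i, 0)) + (\<Sum>i\<in>Basis. f (0, i))"
proof -
  have "(\<lambda>i::'a. (i, 0)) ` Basis \<inter> (\<lambda>i::'b. (0, i)) ` Basis = {}" by auto
  then show ?thesis
    unfolding Basis_prod_def
    by (subst sum.union_disjoint) (simp_all add: sum.reindex inj_on_def)
qed

text \<open>
  Bilinearity and skewness drive the computation of the Laplacian. Both are inherited by
  \<open>\<sigma>\<close>-deformations, so the locale can be interpreted for each of two \<open>\<sigma>\<close>-equivalent algebras.
\<close>
locale skew_family =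
  fixes J :: "'z::euclidean_space \<Rightarrow> 'v::euclidean_space \<Rightarrow> 'v"
  assumes bilinear_J: "bilinear J"
    and skew_J: "J Z X \<bullet> Y = - (X \<bullet> J Z Y)"
begin

lemma linear_J1: "linear (\<lambda>Z. J Z X)" and linear_J2: "linear (J Z)"
  using bilinear_J unfolding bilinear_def by auto

lemma fst_bracket [simp]: "fst (lie_bracket J a b) = 0"
  by (simp add: lie_bracket_def)

lemma bracket_inner: "u \<bullet> lie_bracket J a b = J (snd u) (fst a) \<bullet> fst b"
proof -
  have "J (snd u) (fst a) = J (\<Sum>k\<in>Basis. (snd u \<bullet> k) *\<^sub>R k) (fst a)"
    by (simp add: euclidean_representation)
  also have "\<dots> = (\<Sum>k\<in>Basis. (snd u \<bullet> k) *\<^sub>R J k (fst a))"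
    by (simp add: linear_sum[OF linear_J1] linear_cmul[OF linear_J1])
  finally show ?thesis
    by (cases u) (simp add: lie_bracket_def inner_sum_right inner_sum_left mult.commute)
qed

lemma bracket_skew: "lie_bracket J b a = - lie_bracket J a b"
proof -
  have "w \<bullet> lie_bracket J b a = w \<bullet> - lie_bracket J a b" for w
    using skew_J[of "snd w" "fst b" "fst a"] by (simp add: bracket_inner inner_commute)
  then show ?thesis by (metis vector_eq_ldot)
qed

lemma bracket_self: "lie_bracket J a a = 0"
proof -
  have "2 *\<^sub>R lie_bracket J a a = 0"
    using bracket_skew[of a a] by (simp add: scaleR_2 eq_neg_iff_add_eq_0)
  then show ?thesis by simp
qed

lemma linear_bracket_right: "linear (lie_bracket J a)"
  by (rule linearI)
    (auto simp: lie_bracket_def inner_add_right distrib_right scaleR_add_left sum.distrib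
      scaleR_sum_right)

lemma linear_bracket_left: "linear (\<lambda>a. lie_bracket J a b)"
  by (rule linearI)
    (auto simp: linear_add[OF linear_J2] linear_cmul[OF linear_J2]
      lie_bracket_def inner_add_left scaleR_add_left sum.distrib scaleR_sum_right)

lemmas bracket_linear_simps =
  linear_add[OF linear_bracket_left] linear_add[OF linear_bracket_right]
  linear_diff[OF linear_bracket_left] linear_diff[OF linear_bracket_right]
  linear_neg[OF linear_bracket_left] linear_neg[OF linear_bracket_right]
  linear_cmul[OF linear_bracket_left] linear_cmul[OF linear_bracket_right]

lemma bracket_central: "fst a = 0 \<Longrightarrow> lie_bracket J a b = 0" "fst b = 0 \<Longrightarrow> lie_bracket J a b = 0"
  by (simp_all add: lie_bracket_def linear_0[OF linear_J2] zero_prod_def)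

lemma left_diff_eq: "left_diff J a p u = u + (1/2) *\<^sub>R lie_bracket J a u"
proof -
  have "(group_mult J a has_derivative (\<lambda>u. u + (1/2) *\<^sub>R lie_bracket J a u)) (at p)"
    unfolding group_mult_def
    by (rule derivative_eq_intros linear_imp_has_derivative[OF linear_bracket_right] refl)+ simp
  then show ?thesis
    unfolding left_diff_def by (simp add: frechet_derivative_at[symmetric])
qed

lemma left_field_eq: "left_field J u p = u + (1/2) *\<^sub>R lie_bracket J p u"
  by (simp add: left_field_def left_diff_eq)

lemma left_diff_left_field: "left_diff J (- p) p (left_field J u p) = u"
  by (simp add: left_diff_eq left_field_eq bracket_linear_simps bracket_central)

lemma left_field_left_diff: "left_field J (left_diff J (- p) p w) p = w"
  by (simp add: left_diff_eq left_field_eq bracket_linear_simps bracket_central)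

text \<open>
  This is the chain rule for \<open>L\<^bsub>inverse (a p)\<^esub> L\<^sub>a = L\<^bsub>inverse p\<^esub>\<close>, in the form that yields invariance of the forms
  \<open>\<theta>\<^sub>u\<close>.
\<close>
lemma left_diff_mult: "left_diff J (- group_mult J a p) q (left_diff J a p u) = left_diff J (- p) p u"
  by (simp add: left_diff_eq group_mult_def bracket_linear_simps bracket_central algebra_simps)

lemma dual_form_eq_inner: "dual_form J u p w = u \<bullet> left_diff J (- p) p w"
  by (simp add: dual_form_def left_metric_def left_diff_left_field)

lemma dual_form_eq: "dual_form J u p w = u \<bullet> w - (1/2) * (u \<bullet> lie_bracket J p w)"
  by (simp add: dual_form_eq_inner left_diff_eq bracket_linear_simps inner_diff_right)

lemma dual_form_left_field: "dual_form J u p (left_field J w p) = u \<bullet> w"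
  by (simp add: dual_form_eq_inner left_diff_left_field)

lemma linear_dual_form: "linear (dual_form J u p)"
  by (rule linearI)
    (simp_all add: dual_form_eq bracket_linear_simps inner_add_right algebra_simps)

text \<open>
  Translating back to the identity shows that an invariant form is determined by its value there, a
  linear functional, which the inner product represents by a vector.
\<close>
lemma invariant_forms_eq: "invariant_forms J = range (dual_form J)"
proof (intro equalityI subsetI)
  fix \<eta> assume "\<eta> \<in> invariant_forms J"
  then have lin: "linear (\<eta> p)" and inv: "\<eta> (group_mult J a p) (left_diff J a p u) = \<eta> p u" for a p u
    unfolding invariant_forms_def by blast+
  define u where "u = (\<Sum>b\<in>Basis. \<eta> 0 b *\<^sub>R b)"
  have "\<eta> p w = dual_form J u p w" for p w
  proof -
    let ?w = "left_diff J (- p) p w"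
    have "group_mult J (- p) p = 0"
      by (simp add: group_mult_def bracket_self bracket_linear_simps)
    then have "\<eta> p w = \<eta> 0 ?w" using inv[of "- p" p w] by simp
    also have "\<dots> = u \<bullet> ?w"
      using linear_functional_expansion[OF lin, of 0 ?w]
      by (simp add: u_def inner_sum_left inner_commute[of ?w] mult.commute)
    finally show ?thesis by (simp add: dual_form_eq_inner)
  qed
  then have "\<eta> = dual_form J u" by (simp add: fun_eq_iff)
  then show "\<eta> \<in> range (dual_form J)" by blast
next
  fix \<eta> assume "\<eta> \<in> range (dual_form J)"
  then obtain u where "\<eta> = dual_form J u" by blast
  then show "\<eta> \<in> invariant_forms J"
    unfolding invariant_forms_def mem_Collect_eq
    by (simp only: linear_dual_form dual_form_eq_inner left_diff_mult simp_thms)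
qed

lemma form1_inner_dual_form:
  assumes "linear (\<alpha> p)"
  shows "form1_inner J \<alpha> (dual_form J u) p = \<alpha> p (left_field J u p)"
proof -
  have lin: "linear (\<lambda>u. \<alpha> p (left_field J u p))"
    by (rule linearI)
      (simp_all add: left_field_eq bracket_linear_simps linear_add[OF assms] linear_cmul[OF assms] algebra_simps)
  have "\<alpha> p (left_field J u p) = (\<Sum>b\<in>Basis. (u \<bullet> b) * \<alpha> p (left_field J b p))"
    by (rule linear_functional_expansion[OF lin])
  then show ?thesis
    by (simp add: form1_inner_def dual_form_left_field mult.commute)
qed

lemma form1_inner_commute: "form1_inner J \<alpha> \<beta> p = form1_inner J \<beta> \<alpha> p"
  by (simp add: form1_inner_def mult.commute)

section \<open>The codifferential of an invariant 1-form\<close>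

text \<open>
  Left-invariant fields are divergence free. The field \<open>E\<^sub>u\<close> is the constant field \<open>u\<close> plus central
  directions \<open>(0, k)\<close> with coefficients depending on the \<open>'v\<close>-component of the point only. Such a
  coefficient is constant along \<open>(0, k)\<close> and can therefore be moved under the derivative, which leaves
  constant-direction derivatives of test functions.
\<close>
lemma has_bochner_integral_left_field:
  assumes \<phi>: "test_function \<phi>"
  shows "has_bochner_integral lborel (\<lambda>p. frechet_derivative \<phi> (at p) (left_field J u p)) 0"
proof -
  define l where "l k p = J k (fst p) \<bullet> fst u" for k and p :: "'v \<times> 'z"
  have l: "linear (l k)" for k
    unfolding l_def by (rule linearI)
      (simp_all add: linear_add[OF linear_J2] linear_cmul[OF linear_J2] inner_add_left)
  have \<psi>: "test_function (\<lambda>p. l k p * \<phi> p)" for k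
    using test_function_affine_mult[OF l \<phi>, of 0] by simp
  have D\<psi>: "frechet_derivative (\<lambda>p. l k p * \<phi> p) (at p) (0, k) = l k p * frechet_derivative \<phi> (at p) (0, k)"
    for k p
  proof -
    have "((\<lambda>p. l k p * \<phi> p) has_derivative
        (\<lambda>h. l k p * frechet_derivative \<phi> (at p) h + l k h * \<phi> p)) (at p)"
      by (intro has_derivative_mult linear_imp_has_derivative l test_function_has_derivative \<phi>)
    then have "frechet_derivative (\<lambda>p. l k p * \<phi> p) (at p)
        = (\<lambda>h. l k p * frechet_derivative \<phi> (at p) h + l k h * \<phi> p)"
      by (rule frechet_derivative_at[symmetric])
    then show ?thesis by (simp add: l_def linear_0[OF linear_J2])
  qed
  have "frechet_derivative \<phi> (at p) (left_field J u p) =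
      frechet_derivative \<phi> (at p) u
      + (1/2) * (\<Sum>k\<in>Basis. frechet_derivative (\<lambda>p. l k p * \<phi> p) (at p) (0, k))" for p
  proof -
    have lin: "linear (frechet_derivative \<phi> (at p))"
      using test_function_has_derivative[OF \<phi>] has_derivative_linear by blast
    have "lie_bracket J p u = (\<Sum>k\<in>Basis. l k p *\<^sub>R (0, k))"
      by (simp add: lie_bracket_def l_def sum_prod)
    then show ?thesis
      by (simp only: left_field_eq linear_add[OF lin] linear_cmul[OF lin] linear_sum[OF lin] D\<psi>
          real_scaleR_def)
  qed
  moreover have "has_bochner_integral lborel (\<lambda>p. frechet_derivative \<phi> (at p) u
      + (1/2) * (\<Sum>k\<in>Basis. frechet_derivative (\<lambda>p. l k p * \<phi> p) (at p) (0, k)))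
      (0 + (1/2) * (\<Sum>k\<in>(Basis::'z set). 0))"
    by (intro has_bochner_integral_add has_bochner_integral_mult_right has_bochner_integral_sum
        has_bochner_integral_derivative_test_function \<phi> \<psi>)
  ultimately show ?thesis by simp
qed

lemma codiff1_dual_form: "codiff1 J (dual_form J u) = (\<lambda>_. 0)"
  unfolding codiff1_def
proof (rule the_equality, intro conjI allI impI)
  have int0: "(LINT p|lborel. form1_inner J (dual_form J u) (ext_d0 \<phi>) p) = 0"
    if \<phi>: "test_function \<phi>" for \<phi>
  proof -
    have "linear (ext_d0 \<phi> p)" for p
      using has_derivative_linear[OF test_function_has_derivative[OF \<phi>]]
      unfolding ext_d0_def by (simp add: eta_contract_eq)
    then have "form1_inner J (dual_form J u) (ext_d0 \<phi>) p
        = frechet_derivative \<phi> (at p) (left_field J u p)" for p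
      by (subst form1_inner_commute) (simp add: form1_inner_dual_form ext_d0_def)
    then show ?thesis
      using has_bochner_integral_left_field[OF \<phi>, of u] by (simp add: has_bochner_integral_iff)
  qed
  show "(LINT p|lborel. 0 * \<phi> p) = - (LINT p|lborel. form1_inner J (dual_form J u) (ext_d0 \<phi>) p)"
    if "test_function \<phi>" for \<phi>
    using int0[OF that] by simp
  fix f assume f: "continuous_on UNIV f \<and> (\<forall>\<phi>. test_function \<phi> \<longrightarrow> (LINT p|lborel. f p * \<phi> p)
      = - (LINT p|lborel. form1_inner J (dual_form J u) (ext_d0 \<phi>) p))"
  show "f = (\<lambda>_. 0)"
    by (rule continuous_eq_if_test_integrals_eq) (use f int0 in auto)
qed simp

section \<open>The codifferential of an exact invariant 2-form\<close>

lemma ext_d1_dual_form: "ext_d1 (dual_form J u) p x y = - (u \<bullet> lie_bracket J x y)"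
proof -
  have "frechet_derivative (\<lambda>q. dual_form J u q w) (at p) = (\<lambda>h. - (1/2) * (u \<bullet> lie_bracket J h w))" for w
  proof -
    have "linear (\<lambda>h. (1/2) * (u \<bullet> lie_bracket J h w))"
      by (rule linearI) (simp_all add: bracket_linear_simps inner_add_right)
    from has_derivative_diff[OF has_derivative_const linear_imp_has_derivative[OF this]]
    have "((\<lambda>q. dual_form J u q w) has_derivative (\<lambda>h. - (1/2) * (u \<bullet> lie_bracket J h w))) (at p)"
      by (simp add: dual_form_eq)
    then show ?thesis by (rule frechet_derivative_at[symmetric])
  qed
  then show ?thesis unfolding ext_d1_def by (simp add: bracket_skew[of x y])
qed

lemma bracket_left_field: "lie_bracket J (left_field J x p) (left_field J y p) = lie_bracket J x y"
  by (simp add: left_field_eq bracket_linear_simps bracket_central)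

text \<open>
  The product rule for inserting a moving vector into a 1-form. It is obtained by expanding the vector in
  the standard basis, since regularity is known for constant vectors only.
\<close>
lemma test_form_has_derivative:
  assumes \<alpha>: "test_form \<alpha>" and g: "(g has_derivative g') (at p)"
  shows "((\<lambda>q. \<alpha> q (g q)) has_derivative
    (\<lambda>h. frechet_derivative (\<lambda>q. \<alpha> q (g p)) (at p) h + \<alpha> p (g' h))) (at p)"
proof -
  have lin: "linear (\<alpha> q)" and test: "test_function (\<lambda>q. \<alpha> q w)" for q w
    using \<alpha> unfolding test_form_def by blast+
  have expand: "\<alpha> q w = (\<Sum>b\<in>Basis. (w \<bullet> b) * \<alpha> q b)" for q w
    by (rule linear_functional_expansion[OF lin])
  have D: "((\<lambda>q. \<alpha> q w) has_derivative frechet_derivative (\<lambda>q. \<alpha> q w) (at p)) (at p)" for w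
    by (rule test_function_has_derivative[OF test])
  have "((\<lambda>q. \<Sum>b\<in>Basis. (g p \<bullet> b) * \<alpha> q b) has_derivative
      (\<lambda>h. \<Sum>b\<in>Basis. (g p \<bullet> b) * frechet_derivative (\<lambda>q. \<alpha> q b) (at p) h)) (at p)"
    by (intro has_derivative_sum has_derivative_mult_right D)
  then have const: "frechet_derivative (\<lambda>q. \<alpha> q (g p)) (at p)
      = (\<lambda>h. \<Sum>b\<in>Basis. (g p \<bullet> b) * frechet_derivative (\<lambda>q. \<alpha> q b) (at p) h)"
    by (subst expand) (rule frechet_derivative_at[symmetric])
  have "((\<lambda>q. \<Sum>b\<in>Basis. (g q \<bullet> b) * \<alpha> q b) has_derivative
      (\<lambda>h. \<Sum>b\<in>Basis. (g p \<bullet> b) * frechet_derivative (\<lambda>q. \<alpha> q b) (at p) h + (g' h \<bullet> b) * \<alpha> p b)) (at p)"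
    by (intro has_derivative_sum has_derivative_mult has_derivative_inner_left g D)
  then show ?thesis
    unfolding const unfolding expand[of _ "g _"] expand[of _ "g' _"] by (simp add: sum.distrib)
qed

lemma test_function_test_form_left_field:
  assumes \<alpha>: "test_form \<alpha>"
  shows "test_function (\<lambda>p. \<alpha> p (left_field J u p))"
proof -
  have lin: "linear (\<alpha> p)" and test: "test_function (\<lambda>p. \<alpha> p w)" for p w
    using \<alpha> unfolding test_form_def by blast+
  have "linear (\<lambda>p. (1/2) * (lie_bracket J p u \<bullet> b))" for b
    by (rule linearI) (simp_all add: bracket_linear_simps inner_add_left)
  then have "test_function (\<lambda>p. \<Sum>b\<in>Basis. (u \<bullet> b + (1/2) * (lie_bracket J p u \<bullet> b)) * \<alpha> p b)"
    by (intro test_function_sum test_function_affine_mult test)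
  moreover have "\<alpha> p (left_field J u p)
      = (\<Sum>b\<in>Basis. (u \<bullet> b + (1/2) * (lie_bracket J p u \<bullet> b)) * \<alpha> p b)" for p
    using linear_functional_expansion[OF lin, of p "left_field J u p"]
    by (simp add: left_field_eq inner_add_left)
  ultimately show ?thesis by simp
qed

text \<open>
  Cartan's formula for \<open>d\<alpha>\<close> on left-invariant fields. The derivative of the coefficient of \<open>E\<^sub>y\<close> along
  \<open>E\<^sub>x\<close> is \<open>[x, y]/2\<close>, and the two halves add up to the bracket term.
\<close>
lemma ext_d1_left_field:
  assumes \<alpha>: "test_form \<alpha>"
  shows "ext_d1 \<alpha> p (left_field J x p) (left_field J y p) =
    frechet_derivative (\<lambda>q. \<alpha> q (left_field J y q)) (at p) (left_field J x p)
    - frechet_derivative (\<lambda>q. \<alpha> q (left_field J x q)) (at p) (left_field J y p)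
    - \<alpha> p (lie_bracket J x y)"
proof -
  have lin: "linear (\<alpha> p)" using \<alpha> unfolding test_form_def by blast
  have D: "frechet_derivative (\<lambda>q. \<alpha> q (left_field J w q)) (at p) (left_field J v p) =
      frechet_derivative (\<lambda>q. \<alpha> q (left_field J w p)) (at p) (left_field J v p)
      + (1/2) * \<alpha> p (lie_bracket J v w)" for v w
  proof -
    have "(left_field J w has_derivative (\<lambda>h. (1/2) *\<^sub>R lie_bracket J h w)) (at p)"
      unfolding left_field_eq
      by (rule derivative_eq_intros linear_imp_has_derivative[OF linear_bracket_left] refl)+ simp
    from test_form_has_derivative[OF \<alpha> this]
    have "frechet_derivative (\<lambda>q. \<alpha> q (left_field J w q)) (at p) =
        (\<lambda>h. frechet_derivative (\<lambda>q. \<alpha> q (left_field J w p)) (at p) h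
          + \<alpha> p ((1/2) *\<^sub>R lie_bracket J h w))"
      by (rule frechet_derivative_at[symmetric])
    moreover have "lie_bracket J (left_field J v p) w = lie_bracket J v w"
      by (simp add: left_field_eq bracket_linear_simps bracket_central)
    ultimately show ?thesis by (simp add: linear_cmul[OF lin])
  qed
  show ?thesis
    unfolding ext_d1_def D by (simp add: bracket_skew[of x y] linear_neg[OF lin])
qed

text \<open>
  The symmetric operator with \<open>\<langle>T Z, W\<rangle> = T(Z, W)\<close>; eigenvectors of the form \<open>T\<close> are its eigenvectors.
\<close>
definition T_operator :: "'z \<Rightarrow> 'z" where
  "T_operator Z = (\<Sum>k\<in>Basis. quad_T J Z k *\<^sub>R k)"

lemma quad_T_eq: "quad_T J Z W = - (\<Sum>b\<in>Basis. J Z b \<bullet> J W b)"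
proof -
  have "J Z (J W b) \<bullet> b = - (J Z b \<bullet> J W b)" for b
    using skew_J[of Z "J W b" b] by (simp add: inner_commute)
  then show ?thesis by (simp add: quad_T_def endo_trace_def sum_negf)
qed

lemma linear_quad_T: "linear (quad_T J Z)"
  by (rule linearI) (simp_all add: quad_T_eq linear_add[OF linear_J1] linear_cmul[OF linear_J1]
      inner_add_right sum.distrib sum_distrib_left)

lemma T_operator_inner: "T_operator Z \<bullet> W = quad_T J Z W"
  using linear_functional_expansion[OF linear_quad_T, of Z W]
  by (simp add: T_operator_def inner_sum_left inner_commute[of W] mult.commute)

lemma linear_T_operator: "linear T_operator"
  by (rule linearI; rule vector_eq_rdot[THEN iffD1])
   (simp_all add: T_operator_inner inner_add_left quad_T_eq linear_add[OF linear_J1]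
    linear_cmul[OF linear_J1] sum.distrib sum_distrib_left)

text \<open>
  Paired with a vector \<open>w\<close>, the double sum is \<open>\<Sum>\<^bsub>i,j\<^esub> \<langle>J\<^sub>Z e\<^sub>i, e\<^sub>j\<rangle> \<langle>J\<^sub>W e\<^sub>i, e\<^sub>j\<rangle> = \<Sum>\<^sub>i \<langle>J\<^sub>Z e\<^sub>i, J\<^sub>W e\<^sub>i\<rangle>\<close>
  with \<open>Z\<close>, \<open>W\<close> the central parts of \<open>u\<close>, \<open>w\<close>, and skewness makes this \<open>- Tr (J\<^sub>Z J\<^sub>W)\<close>. The sum runs over
  all ordered pairs, which is why \<open>c = 1\<close> gives \<open>T\<close> itself without a factor one half.
\<close>
lemma bracket_energy:
  "(\<Sum>i\<in>Basis. \<Sum>j\<in>Basis. (u \<bullet> lie_bracket J i j) *\<^sub>R lie_bracket J i j) = (0, - T_operator (snd u))"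
proof (rule vector_eq_rdot[THEN iffD1], rule allI)
  fix w :: "'v \<times> 'z"
  have "(\<Sum>i\<in>Basis. \<Sum>j\<in>Basis. (u \<bullet> lie_bracket J i j) *\<^sub>R lie_bracket J i j) \<bullet> w
     = (\<Sum>i\<in>(Basis :: ('v \<times> 'z) set). \<Sum>j\<in>(Basis :: ('v \<times> 'z) set). (J (snd u) (fst i) \<bullet> fst j) * (J (snd w) (fst i) \<bullet> fst j))"
    by (simp add: inner_sum_left bracket_inner inner_commute[of "lie_bracket J _ _" w])
  also have "\<dots> = (\<Sum>i\<in>Basis. \<Sum>j\<in>Basis. (J (snd u) i \<bullet> j) * (J (snd w) i \<bullet> j))"
    by (simp add: sum_Basis_prod linear_0[OF linear_J2])
  also have "\<dots> = - quad_T J (snd u) (snd w)"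
    by (simp add: quad_T_eq euclidean_inner[of "J (snd u) _" "J (snd w) _"])
  finally show "(\<Sum>i\<in>Basis. \<Sum>j\<in>Basis. (u \<bullet> lie_bracket J i j) *\<^sub>R lie_bracket J i j) \<bullet> w
      = (0, - T_operator (snd u)) \<bullet> w"
    by (cases w) (simp add: T_operator_inner)
qed

text \<open>
  In Cartan's formula the first two terms are left-invariant derivatives of test functions and integrate
  to zero. What remains is a constant combination of the integrals of \<open>\<alpha>\<close> on brackets. Brackets are
  central, where left-invariant fields are constant, so the result is again a pairing with an invariant form.
\<close>
lemma integral_form2_inner_ext_d1:
  assumes \<alpha>: "test_form \<alpha>"
  shows "- (LINT p|lborel. form2_inner c J (ext_d1 (dual_form J u)) (ext_d1 \<alpha>) p)
    = (LINT p|lborel. form1_inner J (dual_form J (0, c *\<^sub>R T_operator (snd u))) \<alpha> p)"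
proof -
  have lin: "linear (\<alpha> p)" and test: "test_function (\<lambda>p. \<alpha> p w)" for p w
    using \<alpha> unfolding test_form_def by blast+
  define I where "I w = (LINT p|lborel. \<alpha> p w)" for w
  have I: "has_bochner_integral lborel (\<lambda>p. \<alpha> p w) (I w)" for w
    using test_function_integrable[OF test, of "\<lambda>_. 1"] by (simp add: I_def has_bochner_integral_iff)
  have lin_I: "linear I"
  proof (rule linearI)
    show "I (x + y) = I x + I y" for x y
      using has_bochner_integral_add[OF I I, of x y] I[of "x + y"]
      by (simp add: linear_add[OF lin] has_bochner_integral_iff)
    show "I (r *\<^sub>R x) = r *\<^sub>R I x" for r x
      by (simp add: I_def linear_cmul[OF lin])
  qed
  have "has_bochner_integral lborel (\<lambda>p. ext_d1 \<alpha> p (left_field J i p) (left_field J j p))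
      (0 - 0 - I (lie_bracket J i j))" for i j
    unfolding ext_d1_left_field[OF \<alpha>]
    by (intro has_bochner_integral_diff has_bochner_integral_left_field
        test_function_test_form_left_field \<alpha> I)
  then have "has_bochner_integral lborel (form2_inner c J (ext_d1 (dual_form J u)) (ext_d1 \<alpha>))
      (c * (\<Sum>i\<in>Basis. \<Sum>j\<in>Basis. - (u \<bullet> lie_bracket J i j) * (0 - 0 - I (lie_bracket J i j))))"
    unfolding form2_inner_def ext_d1_dual_form bracket_left_field
    by (intro has_bochner_integral_mult_right has_bochner_integral_sum)
  then have "(LINT p|lborel. form2_inner c J (ext_d1 (dual_form J u)) (ext_d1 \<alpha>) p)
      = c * (\<Sum>i\<in>Basis. \<Sum>j\<in>Basis. (u \<bullet> lie_bracket J i j) * I (lie_bracket J i j))"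
    by (simp add: has_bochner_integral_iff)
  also have "\<dots> = I (c *\<^sub>R (\<Sum>i\<in>Basis. \<Sum>j\<in>Basis. (u \<bullet> lie_bracket J i j) *\<^sub>R lie_bracket J i j))"
    by (simp add: linear_sum[OF lin_I] linear_cmul[OF lin_I])
  also have "\<dots> = - I (0, c *\<^sub>R T_operator (snd u))"
    unfolding bracket_energy by (simp flip: linear_neg[OF lin_I])
  also have "I (0, c *\<^sub>R T_operator (snd u))
      = (LINT p|lborel. form1_inner J (dual_form J (0, c *\<^sub>R T_operator (snd u))) \<alpha> p)"
  proof -
    have "form1_inner J (dual_form J (0, c *\<^sub>R T_operator (snd u))) \<alpha> p
        = \<alpha> p (0, c *\<^sub>R T_operator (snd u))" for p
      using form1_inner_dual_form[where \<alpha> = \<alpha> and p = p, OF lin]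
      by (subst form1_inner_commute) (simp add: left_field_eq bracket_central)
    then show ?thesis by (simp add: I_def)
  qed
  finally show ?thesis by simp
qed

lemma continuous_dual_form: "continuous_on UNIV (\<lambda>p. dual_form J u p w)"
proof -
  have "continuous_on UNIV (\<lambda>p. lie_bracket J p w)"
    using linear_continuous_on linear_conv_bounded_linear linear_bracket_left by blast
  then show ?thesis unfolding dual_form_eq by (intro continuous_intros)
qed

text \<open>
  For uniqueness, testing against \<open>\<alpha> = \<phi> \<theta>\<^sub>v\<close> isolates the coefficient of the unknown form on \<open>E\<^sub>v\<close>, and
  the fields \<open>E\<^sub>v\<close> span every tangent space.
\<close>
lemma codiff2_ext_d1_dual_form:
  "codiff2 c J (ext_d1 (dual_form J u)) = dual_form J (0, c *\<^sub>R T_operator (snd u))"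
  unfolding codiff2_def
proof (rule the_equality, intro conjI allI impI)
  let ?\<gamma> = "dual_form J (0, c *\<^sub>R T_operator (snd u))"
  show "linear (?\<gamma> p)" for p by (rule linear_dual_form)
  show "continuous_on UNIV (\<lambda>p. ?\<gamma> p w)" for w by (rule continuous_dual_form)
  show "(LINT p|lborel. form1_inner J ?\<gamma> \<alpha> p)
      = - (LINT p|lborel. form2_inner c J (ext_d1 (dual_form J u)) (ext_d1 \<alpha>) p)"
    if "test_form \<alpha>" for \<alpha>
    using integral_form2_inner_ext_d1[OF that] by simp
  fix \<gamma> assume \<gamma>: "(\<forall>p. linear (\<gamma> p)) \<and> (\<forall>w. continuous_on UNIV (\<lambda>p. \<gamma> p w)) \<and>
      (\<forall>\<alpha>. test_form \<alpha> \<longrightarrow> (LINT p|lborel. form1_inner J \<gamma> \<alpha> p)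
        = - (LINT p|lborel. form2_inner c J (ext_d1 (dual_form J u)) (ext_d1 \<alpha>) p))"
  have cont: "continuous_on UNIV (\<lambda>p. \<beta> p (left_field J v p))"
    if "\<And>p. linear (\<beta> p)" "\<And>w. continuous_on UNIV (\<lambda>p. \<beta> p w)" for \<beta> :: "('v \<times> 'z) form1" and v
  proof -
    have "\<beta> p (left_field J v p) = (\<Sum>b\<in>Basis. (left_field J v p \<bullet> b) * \<beta> p b)" for p
      by (rule linear_functional_expansion[OF that(1)])
    moreover have "continuous_on UNIV (left_field J v)"
    proof -
      have "continuous_on UNIV (\<lambda>p. lie_bracket J p v)"
        using linear_continuous_on linear_conv_bounded_linear linear_bracket_left by blast
      then show ?thesis unfolding left_field_eq by (intro continuous_intros)
    qed
    ultimately show ?thesis using that(2) by (simp add: continuous_intros)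
  qed
  have frame: "(\<lambda>p. \<gamma> p (left_field J v p)) = (\<lambda>p. ?\<gamma> p (left_field J v p))" for v
  proof (rule continuous_eq_if_test_integrals_eq)
    show "continuous_on UNIV (\<lambda>p. \<gamma> p (left_field J v p))"
      by (rule cont[where \<beta> = \<gamma>]) (use \<gamma> in blast)+
    show "continuous_on UNIV (\<lambda>p. ?\<gamma> p (left_field J v p))"
      by (rule cont[where \<beta> = ?\<gamma>, OF linear_dual_form continuous_dual_form])
    fix \<phi> :: "'v \<times> 'z \<Rightarrow> real" assume \<phi>: "test_function \<phi>"
    define \<alpha> where "\<alpha> p w = dual_form J v p w * \<phi> p" for p w
    have "test_function (\<lambda>p. \<alpha> p w)" for w
    proof -
      have "linear (\<lambda>p. - (1/2) * (v \<bullet> lie_bracket J p w))"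
        by (rule linearI) (simp_all add: bracket_linear_simps inner_add_right add_divide_distrib)
      from test_function_affine_mult[OF this \<phi>, of "v \<bullet> w"]
      show ?thesis by (simp add: \<alpha>_def dual_form_eq)
    qed
    moreover have "linear (\<alpha> p)" for p
      unfolding \<alpha>_def
      by (rule linearI) (simp_all add: linear_add[OF linear_dual_form]
          linear_cmul[OF linear_dual_form] algebra_simps)
    ultimately have \<alpha>: "test_form \<alpha>" unfolding test_form_def by blast
    have inner: "form1_inner J \<beta> \<alpha> p = \<beta> p (left_field J v p) * \<phi> p" if "linear (\<beta> p)" for \<beta> p
    proof -
      have "form1_inner J \<beta> \<alpha> p = form1_inner J \<beta> (dual_form J v) p * \<phi> p"
        by (simp add: form1_inner_def \<alpha>_def sum_distrib_right mult.assoc)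
      then show ?thesis by (simp add: form1_inner_dual_form[where \<alpha> = \<beta> and p = p, OF that])
    qed
    have "(LINT p|lborel. form1_inner J \<gamma> \<alpha> p) = (LINT p|lborel. form1_inner J ?\<gamma> \<alpha> p)"
      using \<gamma> \<alpha> integral_form2_inner_ext_d1[OF \<alpha>, of c u] by simp
    then show "(LINT p|lborel. \<gamma> p (left_field J v p) * \<phi> p)
        = (LINT p|lborel. ?\<gamma> p (left_field J v p) * \<phi> p)"
      using \<gamma> linear_dual_form by (simp add: inner)
  qed
  have "\<gamma> p w = ?\<gamma> p w" for p w
    using fun_cong[OF frame, of p "left_diff J (- p) p w"] by (simp add: left_field_left_diff)
  then show "\<gamma> = ?\<gamma>" by (simp add: fun_eq_iff)
qed

section \<open>Eigenforms and multiplicities\<close>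

lemma form_scale_dual_form: "form_scale r (dual_form J u) = dual_form J (r *\<^sub>R u)"
  by (simp add: fun_eq_iff form_scale_def dual_form_eq algebra_simps)

lemma laplacian_dual_form:
  "laplacian c J (dual_form J u) = dual_form J (0, - c *\<^sub>R T_operator (snd u))"
proof -
  have "ext_d0 (\<lambda>_ :: 'v \<times> 'z. 0) = 0" by (simp add: ext_d0_def fun_eq_iff)
  then have "laplacian c J (dual_form J u) = form_scale (- 1) (dual_form J (0, c *\<^sub>R T_operator (snd u)))"
    by (simp add: laplacian_def codiff1_dual_form codiff2_ext_d1_dual_form form_scale_def fun_eq_iff)
  then show ?thesis by (simp add: form_scale_dual_form)
qed

lemma inj_dual_form: "inj (dual_form J)"
proof (rule injI)
  fix u v assume "dual_form J u = dual_form J v"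
  then have "u \<bullet> w = v \<bullet> w" for w by (metis dual_form_left_field)
  then show "u = v" by (metis vector_eq_rdot)
qed

lemma laplace_eigenspace_eq:
  "laplace_eigenspace c J \<mu> = dual_form J ` {u. (0, - c *\<^sub>R T_operator (snd u)) = \<mu> *\<^sub>R u}"
  unfolding laplace_eigenspace_def invariant_forms_eq
  by (auto simp: laplacian_dual_form form_scale_dual_form inj_eq[OF inj_dual_form])

text \<open>
  The map \<open>u \<mapsto> \<theta>\<^sub>u\<close> is linear and injective, so the dimension of an eigenspace of forms can be computed
  in \<open>'v \<times> 'z\<close>, where the space depends on \<open>J\<close> through \<open>T\<close> only.
\<close>
lemma laplace_multiplicity_eq:
  "laplace_multiplicity c J \<mu> = dim {u :: 'v \<times> 'z. (0, - c *\<^sub>R T_operator (snd u)) = \<mu> *\<^sub>R u}"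
proof -
  interpret forms: vector_space "form_scale :: real \<Rightarrow> ('v \<times> 'z) form1 \<Rightarrow> ('v \<times> 'z) form1"
    by unfold_locales (simp_all add: fun_eq_iff form_scale_def algebra_simps)
  interpret pair: finite_dimensional_vector_space_pair_1 "(*\<^sub>R) :: real \<Rightarrow> 'v \<times> 'z \<Rightarrow> 'v \<times> 'z" Basis
    "form_scale :: real \<Rightarrow> ('v \<times> 'z) form1 \<Rightarrow> ('v \<times> 'z) form1" ..
  have "Vector_Spaces.linear (*\<^sub>R) form_scale (dual_form J)"
    by unfold_locales
      (simp_all add: form_scale_dual_form, simp add: fun_eq_iff dual_form_eq inner_add_left algebra_simps)
  then show ?thesis
    unfolding laplace_multiplicity_def laplace_eigenspace_eq dim_raw_def[symmetric]
    using pair.dim_image_eq[OF _ inj_on_subset[OF inj_dual_form]] by (simp add: dim_raw_def)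
qed

lemma T_eigenvector_iff: "T_eigenvector J Z \<tau> \<longleftrightarrow> Z \<noteq> 0 \<and> T_operator Z = \<tau> *\<^sub>R Z"
  unfolding T_eigenvector_def by (simp flip: T_operator_inner vector_eq_rdot[of "T_operator Z"])

text \<open>
  For injective \<open>J\<close> the form \<open>T\<close> is negative definite: \<open>T(Z, Z) = - \<Sum>\<^sub>i \<parallel>J\<^sub>Z e\<^sub>i\<parallel>\<^sup>2\<close>. This is what separates the
  Z-forms from the kernel of the Laplacian.
\<close>
lemma T_operator_eq_0_iff:
  assumes "inj J" shows "T_operator Z = 0 \<longleftrightarrow> Z = 0"
proof
  assume "T_operator Z = 0"
  then have "(\<Sum>b\<in>Basis. J Z b \<bullet> J Z b) = 0"
    using T_operator_inner[of Z Z] by (simp add: quad_T_eq)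
  then have "J Z b = 0" if "b \<in> Basis" for b
    using that by (simp add: sum_nonneg_eq_0_iff)
  then have "J Z = J 0"
    using linear_0[OF linear_J1] by (intro linear_eq_stdbasis linear_J2) simp
  then show "Z = 0" using assms by (simp add: inj_eq)
qed (simp add: linear_0[OF linear_T_operator])

end

text \<open>
  An orthogonal involution is symmetric; as \<open>\<sigma>\<close> commutes with \<open>J\<^sub>Z\<close>, the product \<open>\<sigma> J\<^sub>Z\<close> is again skew.
  In \<open>\<sigma> J\<^sub>Z \<sigma> J\<^sub>W\<close> the two factors \<open>\<sigma>\<close> cancel.
\<close>
lemma skew_family_sigma_deformation:
  assumes "skew_family J" "admissible_involution \<sigma> J"
  shows "skew_family (sigma_deformation \<sigma> J)"
    and "quad_T (sigma_deformation \<sigma> J) = quad_T J"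
proof -
  interpret skew_family J by fact
  have \<sigma>: "linear \<sigma>" "\<sigma> x \<bullet> \<sigma> y = x \<bullet> y" "\<sigma> (\<sigma> x) = x" "\<sigma> (J Z x) = J Z (\<sigma> x)" for x y Z
    using assms(2) unfolding admissible_involution_def orthogonal_transformation_def
    by (auto simp: fun_eq_iff)
  have sym: "\<sigma> x \<bullet> y = x \<bullet> \<sigma> y" for x y
    using \<sigma>(2)[of x "\<sigma> y"] by (simp add: \<sigma>(3))
  show "skew_family (sigma_deformation \<sigma> J)"
  proof
    show "bilinear (sigma_deformation \<sigma> J)"
      unfolding bilinear_def sigma_deformation_def
      by (auto intro!: linearI simp: linear_add[OF linear_J1] linear_cmul[OF linear_J1]
          linear_add[OF linear_J2] linear_cmul[OF linear_J2] linear_add[OF \<sigma>(1)] linear_cmul[OF \<sigma>(1)])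
    show "sigma_deformation \<sigma> J Z X \<bullet> Y = - (X \<bullet> sigma_deformation \<sigma> J Z Y)" for Z X Y
      by (simp add: sigma_deformation_def sym skew_J \<sigma>(4))
  qed
  show "quad_T (sigma_deformation \<sigma> J) = quad_T J"
    by (simp add: fun_eq_iff quad_T_def endo_trace_def sigma_deformation_def \<sigma>)
qed

theorem proposition5p1:
  fixes J :: "'z::euclidean_space \<Rightarrow> 'v::euclidean_space \<Rightarrow> 'v" and c :: real
  assumes "metric_two_step_nilpotent J" and "c > 0"
  shows "(\<forall>\<eta> \<mu>. \<eta> \<in> laplace_eigenspace c J \<mu> \<and> \<eta> \<noteq> 0 \<longleftrightarrow>
            (\<exists>Q. Q \<noteq> 0 \<and> \<eta> = X_form J Q \<and> \<mu> = 0) \<or>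
            (\<exists>Z \<tau>. T_eigenvector J Z \<tau> \<and> \<eta> = Z_form J Z \<and> \<mu> = - (c * \<tau>)))
       \<and> (\<forall>\<sigma> \<mu>. admissible_involution \<sigma> J \<longrightarrow>
            laplace_multiplicity c J \<mu> = laplace_multiplicity c (sigma_deformation \<sigma> J) \<mu>)"
proof (intro conjI allI impI)
  have J: "skew_family J" and inj: "inj J"
    using assms(1) unfolding metric_two_step_nilpotent_def skew_family_def by auto
  interpret skew_family J by fact
  fix \<eta> \<mu>
  have zero: "dual_form J u = 0 \<longleftrightarrow> u = 0" for u
  proof -
    have "dual_form J 0 = 0" by (simp add: fun_eq_iff dual_form_eq)
    then show ?thesis by (metis inj_eq[OF inj_dual_form])
  qed
  show "\<eta> \<in> laplace_eigenspace c J \<mu> \<and> \<eta> \<noteq> 0 \<longleftrightarrow>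
      (\<exists>Q. Q \<noteq> 0 \<and> \<eta> = X_form J Q \<and> \<mu> = 0) \<or>
      (\<exists>Z \<tau>. T_eigenvector J Z \<tau> \<and> \<eta> = Z_form J Z \<and> \<mu> = - (c * \<tau>))" (is "?L \<longleftrightarrow> ?A \<or> ?B")
  proof
    assume ?L
    then obtain Q Z where \<eta>: "\<eta> = dual_form J (Q, Z)" and ne: "(Q, Z) \<noteq> 0"
      and Q: "\<mu> *\<^sub>R Q = 0" and Z: "- c *\<^sub>R T_operator Z = \<mu> *\<^sub>R Z"
      by (auto simp: laplace_eigenspace_eq zero)
    show "?A \<or> ?B"
    proof (cases "\<mu> = 0")
      case True
      then have "Z = 0" using Z T_operator_eq_0_iff[OF inj] assms(2) by simp
      then show ?thesis using \<eta> ne True by (auto simp: X_form_def zero_prod_def)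
    next
      case False
      then have "Q = 0" "Z \<noteq> 0" using Q ne by (auto simp: zero_prod_def)
      moreover have "T_operator Z = (- \<mu> / c) *\<^sub>R Z"
      proof -
        have "(- 1 / c) *\<^sub>R (- c *\<^sub>R T_operator Z) = (- 1 / c) *\<^sub>R (\<mu> *\<^sub>R Z)" using Z by simp
        then show ?thesis using assms(2) by simp
      qed
      ultimately have "T_eigenvector J Z (- \<mu> / c)" "\<eta> = Z_form J Z" "\<mu> = - (c * (- \<mu> / c))"
        using assms(2) \<eta> by (auto simp: T_eigenvector_iff Z_form_def)
      then show ?thesis by blast
    qed
  next
    assume "?A \<or> ?B"
    then show ?L
      using linear_0[OF linear_T_operator]
      by (auto simp: laplace_eigenspace_eq zero X_form_def Z_form_def T_eigenvector_iff zero_prod_def)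
  qed
next
  fix \<sigma> \<mu> assume \<sigma>: "admissible_involution \<sigma> J"
  have J: "skew_family J"
    using assms(1) unfolding metric_two_step_nilpotent_def skew_family_def by auto
  interpret A: skew_family J by fact
  interpret B: skew_family "sigma_deformation \<sigma> J" by (rule skew_family_sigma_deformation[OF J \<sigma>])
  show "laplace_multiplicity c J \<mu> = laplace_multiplicity c (sigma_deformation \<sigma> J) \<mu>"
    by (simp add: A.laplace_multiplicity_eq B.laplace_multiplicity_eq A.T_operator_def B.T_operator_def
        skew_family_sigma_deformation(2)[OF J \<sigma>])
qed

end
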